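(* For every $k>4$ and $i\in\{1,2\}$, $$\binom{\lfloor n/2\rfloor}{k-1}\le s_i(n,\# S_k,\mathcal{C})\le \binom{\lceil n/2\rceil}{k-1}.$$
   Context: Let $\mathcal{C}=\{C_3,C_4,\dots\}$ be the family of all cycles. In the $\mathcal{C}$-saturation game on $n$ vertices, Max and Mini alternately claim previously unclaimed edges of $K_n$ so that the graph of claimed edges contains no cycle; the game ends when no edge can be added, i.e. the final graph is a spanning tree. The $H$-score is the number of (not necessarily induced) subgraphs of the final graph isomorphic to $H$. Max maximizes and Mini minimizes the score; $s_1(n,\# H,\mathcal{C})$ is the optimal score when Max starts, $s_2(n,\# H,\mathcal{C})$ when Mini starts. $S_k$ denotes the star on $k$ vertices. *)

theory Defs
  imports Complex_Main
begin

text \<open>A graph is a pair of a vertex set and a set of edges, each edge being a two-element set of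
  vertices. Subgraphs are not necessarily induced.\<close>

type_synonym 'a graph = "'a set \<times> 'a set set"

definition all_edges :: "'a set \<Rightarrow> 'a set set" where
  "all_edges V = {{u, v} |u v. u \<in> V \<and> v \<in> V \<and> u \<noteq> v}"

definition simple_graph :: "'a graph \<Rightarrow> bool" where
  "simple_graph G \<longleftrightarrow> snd G \<subseteq> all_edges (fst G)"

definition subgraph :: "'a graph \<Rightarrow> 'a graph \<Rightarrow> bool" where
  "subgraph K G \<longleftrightarrow> simple_graph K \<and> fst K \<subseteq> fst G \<and> snd K \<subseteq> snd G"

definition graph_iso :: "'a graph \<Rightarrow> 'b graph \<Rightarrow> bool" where
  "graph_iso G H \<longleftrightarrow> (\<exists>f. bij_betw f (fst G) (fst H) \<and> (image f) ` snd G = snd H)"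

definition copies :: "'b graph \<Rightarrow> 'a graph \<Rightarrow> 'a graph set" where
  "copies H G = {K. subgraph K G \<and> graph_iso K H}"

definition family_free :: "'b graph set \<Rightarrow> 'a graph \<Rightarrow> bool" where
  "family_free F G \<longleftrightarrow> (\<forall>H\<in>F. copies H G = {})"

definition cycle_graph :: "nat \<Rightarrow> nat graph" where
  "cycle_graph m = ({..<m}, {{i, Suc i mod m} |i. i < m})"

definition cycle_family :: "nat graph set" where
  "cycle_family = {cycle_graph m |m. m \<ge> 3}"

text \<open>The index of a star counts its vertices, so \<open>star_graph k\<close> has \<open>k - 1\<close> edges.\<close>

definition star_graph :: "nat \<Rightarrow> nat graph" where
  "star_graph k = ({..<k}, {{0, i} |i. 0 < i \<and> i < k})"

text \<open>The players claim edges of the complete graph on \<open>{..<n}\<close>; a position is given by the set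
  of all edges claimed so far.\<close>

definition legal_moves :: "nat graph set \<Rightarrow> nat \<Rightarrow> nat set set \<Rightarrow> nat set set" where
  "legal_moves F n E =
     {e \<in> all_edges {..<n} - E. family_free F ({..<n}, insert e E)}"

datatype player = Maxi | Mini

fun opponent :: "player \<Rightarrow> player" where
  "opponent Maxi = Mini"
| "opponent Mini = Maxi"

lemma finite_all_edges: "finite V \<Longrightarrow> finite (all_edges V)"
  by (rule finite_subset[of _ "Pow V"]) (auto simp: all_edges_def)

text \<open>The score of optimal play from position \<open>E\<close> with player \<open>p\<close> to move, by backward
  induction.\<close>

function game_value ::
  "nat graph set \<Rightarrow> nat graph \<Rightarrow> nat \<Rightarrow> player \<Rightarrow> nat set set \<Rightarrow> nat" where
  "game_value F H n p E =
     (if legal_moves F n E = {} then card (copies H ({..<n}, E))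
      else case p of
        Maxi \<Rightarrow> Max ((\<lambda>e. game_value F H n (opponent p) (insert e E)) ` legal_moves F n E)
      | Mini \<Rightarrow> Min ((\<lambda>e. game_value F H n (opponent p) (insert e E)) ` legal_moves F n E))"
  by pat_completeness auto
termination
proof (relation "measure (\<lambda>(F, H, n, p, E). card (all_edges {..<n} - E))", goal_cases)
  case 1
  show ?case by simp
next
  case (2 F H n p E e)
  then have "all_edges {..<n} - insert e E \<subset> all_edges {..<n} - E"
    by (auto simp: legal_moves_def)
  then show ?case by (simp add: psubset_card_mono finite_all_edges)
next
  case (3 F H n p E e)
  then have "all_edges {..<n} - insert e E \<subset> all_edges {..<n} - E"
    by (auto simp: legal_moves_def)
  then show ?case by (simp add: psubset_card_mono finite_all_edges)
qed

declare game_value.simps [simp del]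

definition s1 :: "nat \<Rightarrow> nat graph \<Rightarrow> nat graph set \<Rightarrow> nat" where
  "s1 n H F = game_value F H n Maxi {}"

definition s2 :: "nat \<Rightarrow> nat graph \<Rightarrow> nat graph set \<Rightarrow> nat" where
  "s2 n H F = game_value F H n Mini {}"

end

theory Submission
  imports Defs "HOL-Library.Transitive_Closure_Table"
begin

text \<open>The legal moves in a forest are the edges between distinct components, so the number of
  components minus one is the number of edges still to be played. A final tree contains
  \<open>\<Sum>v. deg v choose (k - 1)\<close> copies of \<open>S\<^sub>k\<close>.

  Max always plays at one fixed vertex, which gives it degree at least \<open>\<lfloor>n / 2\<rfloor>\<close>.

  Mini bounds \<open>D = \<Sum>v. max 0 (deg v - 3)\<close>. Since \<open>k - 1 > 3\<close>, the function
  \<open>a \<mapsto> 3 + a choose (k - 1)\<close> vanishes at \<open>0\<close> and is convex, hence superadditive, so the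
  score is at most \<open>3 + D choose (k - 1)\<close>. Mini joins leaves of two different components, or a
  leaf to an isolated vertex, which never increases \<open>D\<close> and keeps a single nontrivial
  component after Mini's move. From then on a move of Max has an isolated endpoint and raises \<open>D\<close> by
  at most one. It remains to see that Max wastes two or three moves at the beginning, while the
  degrees are small; if Max starts and \<open>n\<close> is even, three are needed, and Mini achieves this by
  answering the first edge with a disjoint one.\<close>

section \<open>Copies of cycles and stars\<close>

lemma simple_graph_edgeD: "simple_graph G \<Longrightarrow> e \<in> snd G \<Longrightarrow> e \<subseteq> fst G"
  by (auto simp: simple_graph_def all_edges_def)

text \<open>Turns the isomorphism around into an injection of the pattern \<open>H\<close> into the
  host, so that copies become images of \<open>H\<close>. Simplicity keeps each edge inside the
  vertex set, where the inverse map can be applied edgewise.\<close>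

lemma graph_iso_iff_embedding:
  assumes "simple_graph G" "simple_graph H"
  shows "graph_iso G H \<longleftrightarrow> (\<exists>g. inj_on g (fst H) \<and> fst G = g ` fst H \<and> snd G = image g ` snd H)"
proof
  assume "graph_iso G H"
  then obtain f where f: "bij_betw f (fst G) (fst H)" "(image f) ` snd G = snd H"
    by (auto simp: graph_iso_def)
  define g where "g = the_inv_into (fst G) f"
  have g: "bij_betw g (fst H) (fst G)"
    unfolding g_def using f(1) by (rule bij_betw_the_inv_into)
  have "g ` f ` e = e" if "e \<in> snd G" for e
  proof -
    have "e \<subseteq> fst G" using simple_graph_edgeD[OF assms(1) that] .
    then have "\<And>x. x \<in> e \<Longrightarrow> g (f x) = x"
      using f(1) by (auto simp: g_def bij_betw_def the_inv_into_f_f)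
    then show ?thesis by (force simp: image_image)
  qed
  then have "image g ` snd H = snd G"
    unfolding f(2)[symmetric] by (force simp: image_image)
  with g show "\<exists>g. inj_on g (fst H) \<and> fst G = g ` fst H \<and> snd G = image g ` snd H"
    by (intro exI[of _ g]) (auto simp: bij_betw_def)
next
  assume "\<exists>g. inj_on g (fst H) \<and> fst G = g ` fst H \<and> snd G = image g ` snd H"
  then obtain g where g: "inj_on g (fst H)" "fst G = g ` fst H" "snd G = image g ` snd H"
    by blast
  define f where "f = the_inv_into (fst H) g"
  have f: "bij_betw f (fst G) (fst H)"
    unfolding f_def using g by (intro bij_betw_the_inv_into) (auto simp: bij_betw_def)
  have "f ` g ` e = e" if "e \<in> snd H" for e
  proof -
    have "e \<subseteq> fst H" using simple_graph_edgeD[OF assms(2) that] .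
    then have "\<And>x. x \<in> e \<Longrightarrow> f (g x) = x"
      using g(1) by (auto simp: f_def the_inv_into_f_f)
    then show ?thesis by (force simp: image_image)
  qed
  then have "image f ` snd G = snd H"
    unfolding g(3) by (force simp: image_image)
  with f show "graph_iso G H" by (auto simp: graph_iso_def)
qed

lemma simple_graph_embedding:
  assumes "simple_graph H" "inj_on g (fst H)"
  shows "simple_graph (g ` fst H, image g ` snd H)"
  unfolding simple_graph_def
proof
  fix e assume "e \<in> snd (g ` fst H, image g ` snd H)"
  then obtain d where d: "d \<in> snd H" "e = g ` d" by auto
  then obtain x y where "d = {x, y}" "x \<in> fst H" "y \<in> fst H" "x \<noteq> y"
    using assms(1) by (auto simp: simple_graph_def all_edges_def)
  moreover from this have "g x \<noteq> g y" using assms(2) by (auto simp: inj_on_def)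
  ultimately show "e \<in> all_edges (fst (g ` fst H, image g ` snd H))"
    using d(2) by (auto simp: all_edges_def)
qed

lemma copies_eq_embeddings:
  assumes "simple_graph H"
  shows "copies H G = {(g ` fst H, image g ` snd H) |g.
           inj_on g (fst H) \<and> g ` fst H \<subseteq> fst G \<and> image g ` snd H \<subseteq> snd G}"
proof (intro set_eqI iffI)
  fix K assume "K \<in> copies H G"
  then have K: "simple_graph K" "fst K \<subseteq> fst G" "snd K \<subseteq> snd G" "graph_iso K H"
    by (auto simp: copies_def subgraph_def)
  then obtain g where "inj_on g (fst H)" "fst K = g ` fst H" "snd K = image g ` snd H"
    using graph_iso_iff_embedding[OF K(1) assms] by blast
  then show "K \<in> {(g ` fst H, image g ` snd H) |g.
           inj_on g (fst H) \<and> g ` fst H \<subseteq> fst G \<and> image g ` snd H \<subseteq> snd G}"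
    using K(2,3) by (cases K) auto
next
  fix K assume "K \<in> {(g ` fst H, image g ` snd H) |g.
           inj_on g (fst H) \<and> g ` fst H \<subseteq> fst G \<and> image g ` snd H \<subseteq> snd G}"
  then obtain g where g: "K = (g ` fst H, image g ` snd H)" "inj_on g (fst H)"
    "g ` fst H \<subseteq> fst G" "image g ` snd H \<subseteq> snd G" by blast
  have K: "simple_graph K" unfolding g(1) by (rule simple_graph_embedding[OF assms g(2)])
  have "graph_iso K H"
    unfolding graph_iso_iff_embedding[OF K assms] using g by auto
  with K g show "K \<in> copies H G" by (auto simp: copies_def subgraph_def)
qed

lemma simple_cycle_graph:
  assumes "m \<ge> 3"
  shows "simple_graph (cycle_graph m)"
proof -
  have "i \<noteq> Suc i mod m" if "i < m" for i
    using that assms by (cases "Suc i = m") auto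
  moreover have "Suc i mod m < m" for i using assms by simp
  ultimately show ?thesis
    unfolding simple_graph_def cycle_graph_def all_edges_def by fastforce
qed

lemma simple_star_graph: "simple_graph (star_graph k)"
  by (fastforce simp: simple_graph_def star_graph_def all_edges_def)

text \<open>No condition on the vertices remains, because every index \<open>i < m\<close> lies on
  an embedded edge and the edges of \<open>E\<close> stay inside \<open>V\<close>.\<close>

lemma family_free_cycles_iff:
  assumes "E \<subseteq> all_edges V"
  shows "family_free cycle_family (V, E) \<longleftrightarrow>
    \<not> (\<exists>m g. m \<ge> 3 \<and> inj_on g {..<m} \<and> (\<forall>i<m. {g i, g (Suc i mod m)} \<in> E))"
proof -
  have "copies (cycle_graph m) (V, E) \<noteq> {} \<longleftrightarrow>
      (\<exists>g. inj_on g {..<m} \<and> (\<forall>i<m. {g i, g (Suc i mod m)} \<in> E))"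
    if "m \<ge> 3" for m
  proof -
    have sub: "g ` {..<m} \<subseteq> V" if "\<forall>i<m. {g i, g (Suc i mod m)} \<in> E" for g
      using that assms by (force simp: all_edges_def doubleton_eq_iff)
    have fst: "fst (cycle_graph m) = {..<m}"
      and snd: "snd (cycle_graph m) = (\<lambda>i. {i, Suc i mod m}) ` {..<m}"
      by (auto simp: cycle_graph_def)
    have "copies (cycle_graph m) (V, E) \<noteq> {} \<longleftrightarrow>
      (\<exists>g. inj_on g {..<m} \<and> g ` {..<m} \<subseteq> V \<and> (\<forall>i<m. {g i, g (Suc i mod m)} \<in> E))"
      unfolding copies_eq_embeddings[OF simple_cycle_graph[OF that]] fst snd
      by (simp add: image_image image_subset_iff Ball_def)
    then show ?thesis using sub by blast
  qed
  then show ?thesis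
    unfolding family_free_def cycle_family_def by blast
qed

section \<open>Degrees and the number of stars\<close>

definition nbrs :: "'a set set \<Rightarrow> 'a \<Rightarrow> 'a set" where
  "nbrs E v = {w. {v, w} \<in> E}"

definition deg :: "'a set set \<Rightarrow> 'a \<Rightarrow> nat" where
  "deg E v = card (nbrs E v)"

lemma nbrs_subset: "E \<subseteq> all_edges V \<Longrightarrow> nbrs E v \<subseteq> V - {v}"
  by (auto simp: nbrs_def all_edges_def doubleton_eq_iff)

lemma finite_nbrs: "finite V \<Longrightarrow> E \<subseteq> all_edges V \<Longrightarrow> finite (nbrs E v)"
  by (meson nbrs_subset finite_Diff finite_subset)

text \<open>A star is encoded by its centre and its set of leaves. With \<open>k \<ge> 3\<close>
  there are two leaves at least, so the centre is the only vertex common to all edges and can be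
  recovered; a single edge would be counted from both ends.\<close>

lemma card_copies_star:
  fixes V :: "'a set"
  assumes "k \<ge> 3" "finite V" "E \<subseteq> all_edges V"
  shows "card (copies (star_graph k) (V, E)) = (\<Sum>v\<in>V. deg E v choose (k - 1))"
proof -
  define P where "P = (SIGMA v:V. {S. S \<subseteq> nbrs E v \<and> card S = k - 1})"
  define \<phi> :: "'a \<times> 'a set \<Rightarrow> 'a graph"
    where "\<phi> = (\<lambda>(v, S). (insert v S, (\<lambda>s. {v, s}) ` S))"
  have fst_star: "fst (star_graph k) = insert 0 {0<..<k}"
    using assms(1) by (auto simp: star_graph_def)
  have snd_star: "snd (star_graph k) = (\<lambda>i. {0, i}) ` {0<..<k}"
    by (auto simp: star_graph_def)
  have "copies (star_graph k) (V, E) = \<phi> ` P"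
  proof (intro set_eqI iffI)
    fix K assume "K \<in> copies (star_graph k) (V, E)"
    then obtain g where g: "inj_on g (insert 0 {0<..<k})" "g ` insert 0 {0<..<k} \<subseteq> V"
      "image g ` (\<lambda>i. {0, i}) ` {0<..<k} \<subseteq> E"
      "K = (g ` insert 0 {0<..<k}, image g ` (\<lambda>i. {0, i}) ` {0<..<k})"
      unfolding copies_eq_embeddings[OF simple_star_graph] fst_star snd_star by auto
    define S where "S = g ` {0<..<k}"
    have "inj_on g {0<..<k}" using g(1) by (rule inj_on_subset) auto
    then have "card S = k - 1" by (simp add: S_def card_image)
    moreover have "S \<subseteq> nbrs E (g 0)" using g(3) by (auto simp: S_def nbrs_def image_image image_subset_iff)
    moreover have "g 0 \<in> V" using g(2) by auto
    moreover have "K = \<phi> (g 0, S)" unfolding g(4) by (auto simp: \<phi>_def S_def image_image)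
    ultimately show "K \<in> \<phi> ` P" by (auto simp: P_def)
  next
    fix K assume "K \<in> \<phi> ` P"
    then obtain v S where vS: "v \<in> V" "S \<subseteq> nbrs E v" "card S = k - 1" "K = \<phi> (v, S)"
      by (auto simp: P_def)
    have S: "S \<subseteq> V - {v}" using vS(2) nbrs_subset[OF assms(3), of v] by blast
    then have "finite S" using assms(2) by (meson finite_Diff finite_subset)
    then obtain h where h: "bij_betw h {0<..<k} S"
      using vS(3) by (metis card_greaterThanLessThan finite_greaterThanLessThan
          finite_same_card_bij diff_Suc_eq_diff_pred diff_zero)
    define g where "g = h(0 := v)"
    have gS: "g ` {0<..<k} = S" using h by (auto simp: g_def bij_betw_def)
    have g0: "g 0 = v" by (simp add: g_def)
    have "inj_on g {0<..<k}"
      using h by (auto simp: g_def bij_betw_def inj_on_def)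
    then have "inj_on g (insert 0 {0<..<k})"
      using gS g0 S by auto
    moreover have "g ` insert 0 {0<..<k} = insert v S" using gS g0 by auto
    moreover have "image g ` (\<lambda>i. {0, i}) ` {0<..<k} = (\<lambda>s. {v, s}) ` S"
      using g0 by (simp add: image_image gS[symmetric])
    moreover have "insert v S \<subseteq> V" "(\<lambda>s. {v, s}) ` S \<subseteq> E"
      using vS(1,2) S by (auto simp: nbrs_def)
    moreover have "K = (insert v S, (\<lambda>s. {v, s}) ` S)" using vS(4) by (simp add: \<phi>_def)
    ultimately show "K \<in> copies (star_graph k) (V, E)"
      unfolding copies_eq_embeddings[OF simple_star_graph] fst_star snd_star mem_Collect_eq
      by (intro exI[of _ g]) simp
  qed
  moreover have "inj_on \<phi> P"
  proof -
    have center: "v = v'" if "(\<lambda>s. {v, s}) ` S = (\<lambda>s. {v', s}) ` S'" "card S = k - 1" for v v' :: 'a and S S'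
    proof (rule ccontr)
      assume ne: "v \<noteq> v'"
      have "card S \<ge> 2" using that(2) assms(1) by simp
      then obtain a b where ab: "a \<in> S" "b \<in> S" "a \<noteq> b"
        by (metis obtain_subset_with_card_n card_2_iff insert_subset)
      have "{v, a} \<in> (\<lambda>s. {v', s}) ` S'" "{v, b} \<in> (\<lambda>s. {v', s}) ` S'"
        using ab unfolding that(1)[symmetric] by blast+
      then have "v' \<in> {v, a}" "v' \<in> {v, b}" by blast+
      with ne ab(3) show False by auto
    qed
    show ?thesis
    proof (rule inj_onI, clarify)
      fix v S v' S' assume A: "(v, S) \<in> P" "(v', S') \<in> P" "\<phi> (v, S) = \<phi> (v', S')"
      then have v: "v = v'" using center[of v S v' S'] by (auto simp: \<phi>_def P_def)
      moreover have "v \<notin> S" "v' \<notin> S'"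
        using A(1,2) nbrs_subset[OF assms(3)] by (auto simp: P_def)
      ultimately show "v = v' \<and> S = S'" using A(3) by (auto simp: \<phi>_def)
    qed
  qed
  ultimately have "card (copies (star_graph k) (V, E)) = card P"
    by (simp add: card_image)
  also have "\<dots> = (\<Sum>v\<in>V. card {S. S \<subseteq> nbrs E v \<and> card S = k - 1})"
    unfolding P_def using assms(2) finite_nbrs[OF assms(2,3)]
    by (intro card_SigmaI) auto
  also have "\<dots> = (\<Sum>v\<in>V. deg E v choose (k - 1))"
    using finite_nbrs[OF assms(2,3)] by (simp add: n_subsets deg_def)
  finally show ?thesis .
qed

text \<open>By Pascal's rule, raising \<open>a\<close> by one adds \<open>(3 + a) choose l\<close>
  on the left and the larger \<open>(3 + (a + b)) choose l\<close> on the right. The base case rests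
  on \<open>3 choose m = 0\<close>.\<close>

lemma choose_superadditive:
  fixes m :: nat
  assumes "m > 3"
  shows "(3 + a choose m) + (3 + b choose m) \<le> (3 + (a + b)) choose m"
proof (induction a)
  case 0
  then show ?case using assms by simp
next
  case (Suc a)
  obtain l where m: "m = Suc l" using assms by (cases m) auto
  have "(3 + a choose l) \<le> (3 + (a + b)) choose l"
    by (rule binomial_right_mono) auto
  moreover have "3 + Suc a = Suc (3 + a)" "3 + (Suc a + b) = Suc (3 + (a + b))" by simp_all
  ultimately show ?case
    using Suc[unfolded m] unfolding m by (simp only: binomial_Suc_Suc)
qed

text \<open>By superadditivity the sum only grows when all degree beyond 3 is gathered at one
  vertex. Truncated subtraction makes degrees up to 3 free, since such a vertex is the centre of no
  star with \<open>m > 3\<close> leaves.\<close>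

lemma sum_choose_le:
  fixes d :: "'a \<Rightarrow> nat"
  assumes "m > 3" "finite V"
  shows "(\<Sum>v\<in>V. d v choose m) \<le> (3 + (\<Sum>v\<in>V. d v - 3)) choose m"
  using assms(2)
proof (induction V rule: finite_induct)
  case empty
  then show ?case by simp
next
  case (insert x V)
  have "d x choose m \<le> (3 + (d x - 3)) choose m" by (rule binomial_right_mono) auto
  then have "(\<Sum>v\<in>insert x V. d v choose m)
      \<le> (3 + (d x - 3) choose m) + ((3 + (\<Sum>v\<in>V. d v - 3)) choose m)"
    using insert by simp
  also have "\<dots> \<le> (3 + ((d x - 3) + (\<Sum>v\<in>V. d v - 3))) choose m"
    by (rule choose_superadditive[OF assms(1)])
  finally show ?case using insert by simp
qed

section \<open>Components of a forest\<close>

definition conn :: "'a set set \<Rightarrow> 'a \<Rightarrow> 'a \<Rightarrow> bool" where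
  "conn E = (\<lambda>x y. {x, y} \<in> E)\<^sup>*\<^sup>*"

lemma conn_refl [simp, intro]: "conn E x x"
  by (simp add: conn_def)

lemma conn_trans [trans]: "conn E x y \<Longrightarrow> conn E y z \<Longrightarrow> conn E x z"
  unfolding conn_def by (rule rtranclp_trans)

lemma conn_edge: "{x, y} \<in> E \<Longrightarrow> conn E x y"
  unfolding conn_def by (rule r_into_rtranclp)

lemma conn_sym: "conn E x y \<Longrightarrow> conn E y x"
  unfolding conn_def
  by (rule sympD[OF symp_rtranclp]) (auto simp: symp_def insert_commute)

lemma conn_mono: "conn E x y \<Longrightarrow> E \<subseteq> F \<Longrightarrow> conn F x y"
  unfolding conn_def by (erule rtranclp_mono[THEN predicate2D, rotated]) auto

text \<open>A walk needs the new edge at most once: a second crossing only reaches an endpoint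
  already visited.\<close>

lemma conn_insert_iff:
  "conn (insert {u, v} E) x y \<longleftrightarrow>
    conn E x y \<or> conn E x u \<and> conn E v y \<or> conn E x v \<and> conn E u y" (is "?L \<longleftrightarrow> ?R")
proof
  assume ?L
  then show ?R
    unfolding conn_def[of "insert _ _"]
  proof (induction rule: rtranclp_induct)
    case base
    then show ?case by simp
  next
    case (step y z)
    from step(2) have "{y, z} \<in> E \<or> y = u \<and> z = v \<or> y = v \<and> z = u"
      by (auto simp: doubleton_eq_iff)
    then show ?case
      using step(3) conn_edge[of y z E] conn_trans by (metis conn_refl)
  qed
next
  have mono: "conn E a b \<Longrightarrow> conn (insert {u, v} E) a b" for a b
    by (rule conn_mono) auto
  have uv: "conn (insert {u, v} E) u v" by (rule conn_edge) simp
  assume ?R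
  then show ?L
    using mono uv conn_sym[OF uv] by (meson conn_trans)
qed

lemma conn_isolated: "nbrs E x = {} \<Longrightarrow> conn E x y \<Longrightarrow> x = y"
  unfolding conn_def by (erule converse_rtranclpE) (auto simp: nbrs_def)

text \<open>A forest is encoded by a way to build it, each edge joining two components. Positions of
  the game arise in just this way, and the rule induction serves for acyclicity and for
  leaves.\<close>

inductive forest :: "'a set \<Rightarrow> 'a set set \<Rightarrow> bool" for V where
  empty: "forest V {}"
| insert: "forest V E \<Longrightarrow> u \<in> V \<Longrightarrow> v \<in> V \<Longrightarrow> \<not> conn E u v \<Longrightarrow> forest V (insert {u, v} E)"

lemma forest_edges: "forest V E \<Longrightarrow> E \<subseteq> all_edges V"
  by (induction rule: forest.induct) (auto simp: all_edges_def)

text \<open>By the induction hypothesis a cycle must use the newest edge \<open>{u, v}\<close>; its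
  other edges then connect \<open>u\<close> with \<open>v\<close> inside \<open>E\<close>, against
  the choice of that edge.\<close>

lemma forest_cycle_free:
  assumes "forest V E"
  shows "family_free cycle_family (V, E)"
proof -
  have "\<not> (inj_on g {..<m} \<and> (\<forall>i<m. {g i, g (Suc i mod m)} \<in> E))" if "m \<ge> 3"
    for m and g :: "nat \<Rightarrow> 'a"
    using assms
  proof (induction rule: forest.induct)
    case empty
    then show ?case using that by (auto intro!: exI[of _ 0])
  next
    case (insert E u v)
    show ?case
    proof
      assume cyc: "inj_on g {..<m} \<and> (\<forall>i<m. {g i, g (Suc i mod m)} \<in> insert {u, v} E)"
      then obtain i where i: "i < m" "{g i, g (Suc i mod m)} = {u, v}"
        using insert.IH by blast
      \<comment> \<open>Different positions carry different edges: otherwise \<open>i\<close> and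
        \<open>j\<close> would be successors of each other modulo \<open>m\<close>, forcing
        \<open>m\<close> to be at most 2.\<close>
      have other: "{g j, g (Suc j mod m)} \<in> E" if j: "j < m" "j \<noteq> i" for j
      proof -
        have "{g j, g (Suc j mod m)} \<noteq> {g i, g (Suc i mod m)}"
        proof
          assume "{g j, g (Suc j mod m)} = {g i, g (Suc i mod m)}"
          moreover have "inj_on g {..<m}" "Suc i mod m < m" "Suc j mod m < m"
            using cyc \<open>m \<ge> 3\<close> by auto
          moreover have "g j \<noteq> g i" using calculation(2) i(1) j by (simp add: inj_on_eq_iff)
          ultimately have "g j = g (Suc i mod m)" "g i = g (Suc j mod m)"
            unfolding doubleton_eq_iff by simp_all
          then have succ: "j = Suc i mod m" "i = Suc j mod m"
            using \<open>inj_on g {..<m}\<close> \<open>Suc i mod m < m\<close> \<open>Suc j mod m < m\<close> i(1) j(1)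
            by (metis inj_onD lessThan_iff)+
          have Suc_mod: "Suc l = m \<and> Suc l mod m = 0 \<or> Suc l mod m = Suc l" if "l < m" for l
            using that by (cases "Suc l = m") auto
          have "Suc i = m \<and> j = 0 \<or> j = Suc i"
            using Suc_mod[OF i(1)] unfolding succ(1)[symmetric] .
          moreover have "Suc j = m \<and> i = 0 \<or> i = Suc j"
            using Suc_mod[OF j(1)] unfolding succ(2)[symmetric] .
          ultimately show False using \<open>m \<ge> 3\<close> by (elim disjE conjE) linarith+
        qed
        with cyc j i(2) show ?thesis by auto
      qed
      \<comment> \<open>Walk around the cycle from the far end of edge \<open>i\<close>. Position
        \<open>i\<close> is reached only after \<open>m - 1\<close> steps, so every step uses an old
        edge.\<close>
      have "conn E (g (Suc i mod m)) (g ((Suc i + t) mod m))" if "t < m" for t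
        using that
      proof (induction t)
        case 0
        then show ?case by simp
      next
        case (Suc t)
        have "(Suc i + t) mod m \<noteq> i"
          using Suc.prems i(1) by (cases "Suc i + t < m") (auto simp: mod_if)
        then have "{g ((Suc i + t) mod m), g (Suc ((Suc i + t) mod m) mod m)} \<in> E"
          using i(1) by (intro other) auto
        then have "conn E (g ((Suc i + t) mod m)) (g ((Suc i + Suc t) mod m))"
          by (intro conn_edge) (simp add: mod_Suc_eq)
        with Suc show ?case by (auto intro: conn_trans)
      qed
      from this[of "m - 1"] have "conn E (g (Suc i mod m)) (g i)"
        using i(1) by simp
      then have "conn E u v"
        using i(2) by (auto simp: doubleton_eq_iff intro: conn_sym)
      with insert.hyps show False by blast
    qed
  qed
  then show ?thesis
    unfolding family_free_cycles_iff[OF forest_edges[OF assms]] by blast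
qed

text \<open>Shorten the walk to a path without repeated vertices and close it with the new edge.
  Since \<open>{u, v}\<close> is not in \<open>E\<close>, the path has at least two edges, so the
  cycle has length at least 3.\<close>

lemma conn_imp_closes_cycle:
  assumes "E \<subseteq> all_edges V" "u \<in> V" "v \<in> V" "u \<noteq> v" "conn E u v" "{u, v} \<notin> E"
  shows "\<not> family_free cycle_family (V, insert {u, v} E)"
proof -
  obtain xs where "rtrancl_path (\<lambda>x y. {x, y} \<in> E) u xs v"
    using assms(5) unfolding conn_def rtranclp_eq_rtrancl_path by blast
  then obtain ys where ys: "rtrancl_path (\<lambda>x y. {x, y} \<in> E) u ys v" "distinct (u # ys)"
    by (rule rtrancl_path_distinct)
  \<comment> \<open>The list in \<open>rtrancl_path\<close> omits the starting vertex;
    \<open>L\<close> restores it and enumerates the cycle.\<close>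
  define L where "L = u # ys"
  have step: "{L ! i, ys ! i} \<in> E" if "i < length ys" for i
    using rtrancl_path_nth[OF ys(1) that] by (simp add: L_def)
  have "ys \<noteq> []" using ys(1) assms(4) by (auto elim: rtrancl_path.cases)
  then have last: "last ys = v" using rtrancl_path_last[OF ys(1)] by simp
  have "length ys \<noteq> 1"
  proof
    assume "length ys = 1"
    then have "ys = [v]" using last by (cases ys) auto
    then show False using step[of 0] assms(6) by (simp add: L_def)
  qed
  with \<open>ys \<noteq> []\<close> have len: "length L \<ge> 3"
    by (cases ys; cases "tl ys") (auto simp: L_def)
  have "{L ! i, L ! (Suc i mod length L)} \<in> insert {u, v} E" if "i < length L" for i
  proof (cases "i < length ys")
    case True
    then show ?thesis using step[OF True] by (simp add: L_def)
  next
    case False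
    then have i: "i = length ys" using that by (simp add: L_def)
    then have "L ! i = v" using \<open>ys \<noteq> []\<close> last by (simp add: L_def last_conv_nth nth_Cons')
    then show ?thesis using i by (simp add: L_def insert_commute)
  qed
  moreover have "inj_on (nth L) {..<length L}"
    using ys(2) by (auto simp: L_def inj_on_nth)
  moreover have "insert {u, v} E \<subseteq> all_edges V"
    using assms by (auto simp: all_edges_def)
  ultimately show ?thesis
    using len family_free_cycles_iff[of "insert {u, v} E" V] by blast
qed

text \<open>Replaces cycles by connectivity for the rest of the proof. The condition
  \<open>\<not> conn E u v\<close> also covers \<open>u \<noteq> v\<close> and the edge being
  unclaimed.\<close>

lemma legal_moves_forest:
  assumes "forest {..<n} E"
  shows "legal_moves cycle_family n E = {{u, v} |u v. u < n \<and> v < n \<and> \<not> conn E u v}"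
proof (intro set_eqI iffI)
  fix e assume "e \<in> legal_moves cycle_family n E"
  then obtain u v where "e = {u, v}" "u < n" "v < n" "u \<noteq> v" "e \<notin> E"
    "family_free cycle_family ({..<n}, insert e E)"
    by (auto simp: legal_moves_def all_edges_def)
  then show "e \<in> {{u, v} |u v. u < n \<and> v < n \<and> \<not> conn E u v}"
    using conn_imp_closes_cycle[OF forest_edges[OF assms], of u v] by blast
next
  fix e assume "e \<in> {{u, v} |u v. u < n \<and> v < n \<and> \<not> conn E u v}"
  then obtain u v where e: "e = {u, v}" "u < n" "v < n" "\<not> conn E u v" by blast
  then have "u \<noteq> v" "e \<notin> E" by (auto intro: conn_edge)
  moreover have "family_free cycle_family ({..<n}, insert {u, v} E)"
    using e by (intro forest_cycle_free forest.insert assms) auto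
  ultimately show "e \<in> legal_moves cycle_family n E"
    using e by (auto simp: legal_moves_def all_edges_def)
qed

section \<open>Degrees and leaves of a forest\<close>

lemma nbrs_insert_edge:
  assumes "u \<noteq> v"
  shows "nbrs (insert {u, v} E) w =
    (if w = u then insert v (nbrs E w) else if w = v then insert u (nbrs E w) else nbrs E w)"
  using assms by (auto simp: nbrs_def doubleton_eq_iff)

lemma deg_insert_edge:
  assumes "finite V" "forest V E" "\<not> conn E u v"
  shows "deg (insert {u, v} E) w = deg E w + (if w = u \<or> w = v then 1 else 0)"
proof -
  have "u \<noteq> v" using assms(3) by auto
  moreover have "v \<notin> nbrs E u" "u \<notin> nbrs E v"
    using assms(3) conn_edge conn_sym by (fastforce simp: nbrs_def)+
  ultimately show ?thesis
    using finite_nbrs[OF assms(1) forest_edges[OF assms(2)]]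
    by (simp add: deg_def nbrs_insert_edge)
qed

lemma deg_0_conn:
  assumes "finite V" "forest V E" "deg E x = 0" "conn E x y"
  shows "x = y"
proof (rule conn_isolated[OF _ assms(4)])
  show "nbrs E x = {}"
    using assms(3) finite_nbrs[OF assms(1) forest_edges[OF assms(2)]] by (simp add: deg_def)
qed

text \<open>Supplies the leaves that Mini joins. Two are asked for so that the induction goes
  through: a new edge ending at one of them leaves the other.\<close>

lemma forest_two_leaves:
  assumes "finite V" "forest V E" "deg E x > 0"
  shows "\<exists>a b. a \<noteq> b \<and> deg E a = 1 \<and> deg E b = 1 \<and> conn E x a \<and> conn E x b"
  using assms(2,3)
proof (induction arbitrary: x rule: forest.induct)
  case empty
  then show ?case by (simp add: deg_def nbrs_def)
next
  case (insert E u v)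
  let ?E = "insert {u, v} E"
  note deg = deg_insert_edge[OF assms(1) insert.hyps(1,4)]
  have vu: "\<not> conn E v u" using insert.hyps(4) conn_sym[of E v u] by blast
  \<comment> \<open>Each side of the new edge keeps a leaf: an endpoint that was isolated becomes one, and a
    nontrivial component loses at most one of its two.\<close>
  have leaf: "\<exists>a. deg ?E a = 1 \<and> conn E z a" if z: "z = u \<or> z = v" for z
  proof (cases "deg E z = 0")
    case True
    then show ?thesis using z deg by (intro exI[of _ z]) auto
  next
    case False
    then have "deg E z > 0" by simp
    from insert.IH[OF this] obtain a b
      where ab: "a \<noteq> b" "deg E a = 1" "deg E b = 1" "conn E z a" "conn E z b" by blast
    obtain c where c: "c \<noteq> z" "deg E c = 1" "conn E z c"
      using ab that[of a] that[of b] by (cases "a = z") auto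
    have "c \<noteq> u" "c \<noteq> v"
      using z c vu insert.hyps(4) by auto
    then show ?thesis using c deg by (intro exI[of _ c]) auto
  qed
  obtain a where a: "deg ?E a = 1" "conn E u a" using leaf by blast
  obtain b where b: "deg ?E b = 1" "conn E v b" using leaf by blast
  have "a \<noteq> b"
    using insert.hyps(4) conn_trans[OF a(2) conn_sym, of v] b(2) by blast
  show ?case
  proof (cases "conn ?E x u")
    case True
    moreover have "conn ?E u a" "conn ?E u b"
      using a b by (auto simp: conn_insert_iff)
    ultimately have "conn ?E x a" "conn ?E x b"
      using conn_trans[of ?E x u] by blast+
    then show ?thesis using a b \<open>a \<noteq> b\<close> by blast
  next
    case False
    then have nc: "x \<noteq> u" "x \<noteq> v" "\<not> conn E x u" "\<not> conn E x v"
      by (auto simp: conn_insert_iff)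
    then have "deg E x > 0" using insert.prems deg by auto
    from insert.IH[OF this] obtain a b
      where ab: "a \<noteq> b" "deg E a = 1" "deg E b = 1" "conn E x a" "conn E x b" by blast
    then have "a \<noteq> u" "a \<noteq> v" "b \<noteq> u" "b \<noteq> v" using nc by auto
    then show ?thesis using ab deg
      by (intro exI[of _ a] exI[of _ b]) (auto simp: conn_insert_iff)
  qed
qed

section \<open>Counting components\<close>

definition comps :: "'a set set \<Rightarrow> 'a set \<Rightarrow> 'a set set" where
  "comps E A = (\<lambda>x. Collect (conn E x)) ` A"

lemma conn_left_cong: "conn E x y \<Longrightarrow> conn E x z \<longleftrightarrow> conn E y z"
  using conn_trans[of E x y z] conn_trans[of E y x z] conn_sym[of E x y] by blast

lemma conn_class_eq_iff: "Collect (conn E x) = Collect (conn E y) \<longleftrightarrow> conn E x y"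
  by (auto intro: conn_sym conn_trans)

text \<open>The classes of \<open>u\<close> and \<open>v\<close> give way to their union, while the
  classes of \<open>?B\<close> stay the same. The set \<open>A\<close> of representatives is
  arbitrary, so that the count applies to all components and also to the nontrivial ones.\<close>

lemma card_comps_insert_edge:
  assumes "finite A" "u \<in> A" "v \<in> A" "\<not> conn E u v"
  shows "Suc (card (comps (insert {u, v} E) A)) = card (comps E A)"
proof -
  let ?C = "\<lambda>x. Collect (conn E x)"
  let ?B = "{x \<in> A. \<not> conn E x u \<and> \<not> conn E x v}"
  have fin: "finite (?C ` ?B)" using assms(1) by simp
  have "comps E A = insert (?C u) (insert (?C v) (?C ` ?B))"
  proof -
    have "?C x = ?C u" if "conn E x u" for x using that unfolding conn_class_eq_iff .
    moreover have "?C x = ?C v" if "conn E x v" for x using that unfolding conn_class_eq_iff .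
    ultimately show ?thesis unfolding comps_def using assms(2,3) by blast
  qed
  moreover have "?C u \<notin> insert (?C v) (?C ` ?B)" "?C v \<notin> ?C ` ?B"
    using assms(4) by (auto simp: conn_class_eq_iff image_iff intro: conn_sym)
  ultimately have 1: "card (comps E A) = Suc (Suc (card (?C ` ?B)))"
    using fin by simp
  have merged: "Collect (conn (insert {u, v} E) x) = ?C u \<union> ?C v" if "conn E x u \<or> conn E x v" for x
    using that
  proof
    assume "conn E x u"
    then have "conn E x = conn E u" by (intro ext conn_left_cong)
    then show ?thesis by (auto simp: conn_insert_iff)
  next
    assume "conn E x v"
    then have "conn E x = conn E v" by (intro ext conn_left_cong)
    then show ?thesis by (auto simp: conn_insert_iff)
  qed
  have kept: "Collect (conn (insert {u, v} E) x) = ?C x" if "\<not> conn E x u \<and> \<not> conn E x v" for x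
    using that by (auto simp: conn_insert_iff)
  have "comps (insert {u, v} E) A = insert (?C u \<union> ?C v) (?C ` ?B)"
  proof (intro set_eqI iffI)
    fix c assume "c \<in> comps (insert {u, v} E) A"
    then obtain x where x: "x \<in> A" "c = Collect (conn (insert {u, v} E) x)"
      by (auto simp: comps_def)
    then show "c \<in> insert (?C u \<union> ?C v) (?C ` ?B)"
      using merged[of x] kept[of x] by (cases "conn E x u \<or> conn E x v") auto
  next
    fix c assume c: "c \<in> insert (?C u \<union> ?C v) (?C ` ?B)"
    then show "c \<in> comps (insert {u, v} E) A"
    proof
      assume "c = ?C u \<union> ?C v"
      then show ?thesis using merged[of u] assms(2) by (auto simp: comps_def image_iff)
    next
      assume "c \<in> ?C ` ?B"
      then obtain x where "x \<in> ?B" "c = ?C x" by blast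
      then show ?thesis using kept[of x] by (auto simp: comps_def image_iff)
    qed
  qed
  moreover have "?C u \<union> ?C v \<notin> ?C ` ?B" by auto
  ultimately show ?thesis using 1 fin by simp
qed

text \<open>The number of moves left, whoever makes them, since each move merges two components and
  play ends with one. It is the induction measure for both strategies.\<close>

definition rest :: "'a set \<Rightarrow> 'a set set \<Rightarrow> nat" where
  "rest V E = card (comps E V) - 1"

lemma rest_insert_edge:
  assumes "finite V" "u \<in> V" "v \<in> V" "\<not> conn E u v"
  shows "rest V E = Suc (rest V (insert {u, v} E))"
proof -
  have "comps (insert {u, v} E) V \<noteq> {}" "finite (comps (insert {u, v} E) V)"
    using assms by (auto simp: comps_def)
  then have "card (comps (insert {u, v} E) V) > 0" by (simp add: card_gt_0_iff)
  then show ?thesis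
    using card_comps_insert_edge[OF assms] by (simp add: rest_def)
qed

lemma rest_pos_iff:
  assumes "finite V"
  shows "rest V E > 0 \<longleftrightarrow> (\<exists>u\<in>V. \<exists>v\<in>V. \<not> conn E u v)"
proof
  assume "rest V E > 0"
  then have "\<not> is_singleton (comps E V) \<and> comps E V \<noteq> {}"
    by (auto simp: rest_def is_singleton_altdef)
  then obtain c d where "c \<in> comps E V" "d \<in> comps E V" "c \<noteq> d"
    by (metis is_singletonI' ex_in_conv)
  then obtain u v where "u \<in> V" "v \<in> V" "Collect (conn E u) \<noteq> Collect (conn E v)"
    unfolding comps_def by blast
  then show "\<exists>u\<in>V. \<exists>v\<in>V. \<not> conn E u v"
    unfolding conn_class_eq_iff by blast
next
  assume "\<exists>u\<in>V. \<exists>v\<in>V. \<not> conn E u v"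
  then show "rest V E > 0" using rest_insert_edge[OF assms] by fastforce
qed

lemma rest_empty: "rest V {} = card V - 1"
proof -
  have "conn {} x y \<longleftrightarrow> x = y" for x y :: 'a
    using conn_isolated[of "{}" x y] by (auto simp: nbrs_def)
  then have "inj_on (\<lambda>x. Collect (conn {} x)) V" by (auto simp: inj_on_def)
  then show ?thesis by (simp add: rest_def comps_def card_image)
qed

lemma forest_not_conn_of_rest:
  assumes "finite V" "v \<in> V" "rest V E > 0"
  shows "\<exists>w\<in>V. \<not> conn E v w"
  using assms rest_pos_iff[of V E] by (meson conn_sym conn_trans)

section \<open>Components that contain an edge\<close>

definition nontriv :: "'a set \<Rightarrow> 'a set set \<Rightarrow> nat" where
  "nontriv V E = card (comps E {v \<in> V. deg E v > 0})"

text \<open>Adjoin both endpoints to the representatives, each isolated one bringing a class of its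
  own; the new edge then merges two classes. The equation is additive because subtraction on
  \<open>nat\<close> truncates.\<close>

lemma nontriv_insert_edge:
  assumes "finite V" "forest V E" "u \<in> V" "v \<in> V" "\<not> conn E u v"
  shows "nontriv V (insert {u, v} E) + (if deg E u > 0 then 1 else 0)
    + (if deg E v > 0 then 1 else 0) = nontriv V E + 1"
proof -
  let ?N = "{x \<in> V. deg E x > 0}"
  let ?C = "\<lambda>x. Collect (conn E x)"
  have N: "{x \<in> V. deg (insert {u, v} E) x > 0} = insert u (insert v ?N)"
    using assms(3,4) by (auto simp: deg_insert_edge[OF assms(1,2,5)])
  have fin: "finite (?C ` ?N)" using assms(1) by simp
  have new: "?C z \<notin> ?C ` A" if "deg E z = 0" "z \<notin> A" for z A
    using that deg_0_conn[OF assms(1,2)] by (auto simp: image_iff conn_class_eq_iff)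
  have old: "?C z \<in> ?C ` ?N" if "deg E z > 0" "z \<in> V" for z
    using that by auto
  have "u \<noteq> v" using assms(5) by auto
  have "card (comps E (insert u (insert v ?N))) + (if deg E u > 0 then 1 else 0)
    + (if deg E v > 0 then 1 else 0) = card (?C ` ?N) + 2"
    using fin new[of v ?N] new[of u "insert v ?N"] new[of u ?N] old[of u] old[of v] \<open>u \<noteq> v\<close> assms(3,4)
    by (auto simp: comps_def insert_absorb card_insert_if)
  moreover have "Suc (card (comps (insert {u, v} E) (insert u (insert v ?N)))) =
      card (comps E (insert u (insert v ?N)))"
    using assms by (intro card_comps_insert_edge) auto
  ultimately show ?thesis unfolding nontriv_def N by (simp add: comps_def)
qed

text \<open>Used in the contrapositive: while at most one component is nontrivial, every legal edge
  has an isolated end.\<close>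

lemma nontriv_le_1_conn:
  assumes "finite V" "nontriv V E \<le> 1" "x \<in> V" "y \<in> V" "deg E x > 0" "deg E y > 0"
  shows "conn E x y"
proof -
  let ?S = "comps E {v \<in> V. deg E v > 0}"
  have "finite ?S" using assms(1) by (simp add: comps_def)
  moreover have "Collect (conn E x) \<in> ?S" "Collect (conn E y) \<in> ?S"
    using assms by (auto simp: comps_def)
  ultimately have "Collect (conn E x) = Collect (conn E y)"
    using assms(2) card_le_Suc0_iff_eq[of ?S] by (simp add: nontriv_def)
  then show ?thesis unfolding conn_class_eq_iff .
qed

section \<open>Backward induction\<close>

lemma game_value_end:
  "legal_moves F n E = {} \<Longrightarrow> game_value F H n p E = card (copies H ({..<n}, E))"
  by (subst game_value.simps) simp

lemma finite_legal_moves: "finite (legal_moves F n E)"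
  unfolding legal_moves_def by (simp add: finite_all_edges)

text \<open>This and the next three rules turn the minimax recursion into strategy arguments: the
  player whose strategy is followed exhibits one move, while all moves of the opponent are
  considered.\<close>

lemma game_value_Maxi_ge:
  "e \<in> legal_moves F n E \<Longrightarrow> game_value F H n Mini (insert e E) \<le> game_value F H n Maxi E"
  by (subst (2) game_value.simps) (auto simp: finite_legal_moves)

lemma game_value_Mini_le:
  "e \<in> legal_moves F n E \<Longrightarrow> game_value F H n Mini E \<le> game_value F H n Maxi (insert e E)"
  by (subst game_value.simps) (auto simp: finite_legal_moves)

lemma game_value_Maxi_le:
  assumes "legal_moves F n E \<noteq> {}"
    and "\<And>e. e \<in> legal_moves F n E \<Longrightarrow> game_value F H n Mini (insert e E) \<le> b"
  shows "game_value F H n Maxi E \<le> b"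
  using assms by (subst game_value.simps) (auto simp: finite_legal_moves)

lemma game_value_Mini_ge:
  assumes "legal_moves F n E \<noteq> {}"
    and "\<And>e. e \<in> legal_moves F n E \<Longrightarrow> b \<le> game_value F H n Maxi (insert e E)"
  shows "b \<le> game_value F H n Mini E"
  using assms by (subst game_value.simps) (auto simp: finite_legal_moves)

lemma legal_moves_empty_iff:
  "forest {..<n} E \<Longrightarrow> legal_moves cycle_family n E = {} \<longleftrightarrow> rest {..<n} E = 0"
  using rest_pos_iff[of "{..<n}" E] by (auto simp: legal_moves_forest)

lemma legal_moves_forestE:
  assumes "forest {..<n} E" "e \<in> legal_moves cycle_family n E"
  obtains u v where "e = {u, v}" "u < n" "v < n" "\<not> conn E u v"
    "forest {..<n} (insert e E)" "rest {..<n} E = Suc (rest {..<n} (insert e E))"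
proof -
  obtain u v where uv: "e = {u, v}" "u < n" "v < n" "\<not> conn E u v"
    using assms by (auto simp: legal_moves_forest)
  then show thesis
    using that[of u v] forest.insert[OF assms(1), of u v] rest_insert_edge[of "{..<n}" u v E]
    by simp
qed

lemma game_value_forest_end:
  assumes "k \<ge> 3" "forest {..<n} E" "rest {..<n} E = 0"
  shows "game_value cycle_family (star_graph k) n p E = (\<Sum>v<n. deg E v choose (k - 1))"
  using assms legal_moves_empty_iff[OF assms(2)] card_copies_star[OF assms(1) _ forest_edges[OF assms(2)]]
  by (simp add: game_value_end)

section \<open>The strategy of Max\<close>

text \<open>The bound on \<open>m\<close> is the degree of \<open>v\<close> after Max has spent all
  remaining moves there; Max has the larger half of them when to move and the smaller half
  otherwise. Such a move exists as long as \<open>rest\<close> is positive, and stars centred at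
  \<open>v\<close> alone give the score.\<close>

lemma game_value_star_lower:
  assumes "k \<ge> 3" "forest {..<n} E" "v < n"
    and "m \<le> deg E v + (case p of Maxi \<Rightarrow> (rest {..<n} E + 1) div 2 | Mini \<Rightarrow> rest {..<n} E div 2)"
  shows "m choose (k - 1) \<le> game_value cycle_family (star_graph k) n p E"
  using assms(2,4)
proof (induction "rest {..<n} E" arbitrary: E p)
  case 0
  then have "m \<le> deg E v" by (cases p) auto
  then have "m choose (k - 1) \<le> deg E v choose (k - 1)" by (rule binomial_right_mono)
  also have "\<dots> \<le> (\<Sum>v<n. deg E v choose (k - 1))"
    using assms(3) by (intro member_le_sum) auto
  finally show ?case using 0 by (simp add: game_value_forest_end[OF assms(1)])
next
  case (Suc r)
  note deg = deg_insert_edge[OF finite_lessThan Suc.prems(1)]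
  show ?case
  proof (cases p)
    case Maxi
    obtain w where w: "w < n" "\<not> conn E v w"
      using forest_not_conn_of_rest[of "{..<n}" v E] assms(3) Suc.hyps(2) by auto
    then have e: "{v, w} \<in> legal_moves cycle_family n E"
      using Suc.prems(1) assms(3) by (auto simp: legal_moves_forest)
    have f: "forest {..<n} (insert {v, w} E)"
      using w assms(3) Suc.prems(1) by (intro forest.insert) auto
    have r: "r = rest {..<n} (insert {v, w} E)"
      using rest_insert_edge[of "{..<n}" v w E] w assms(3) Suc.hyps(2) by simp
    have "m choose (k - 1) \<le> game_value cycle_family (star_graph k) n Mini (insert {v, w} E)"
      using Suc.prems(2) Suc.hyps(2) r deg[OF w(2)] Maxi by (intro Suc.hyps(1) f) auto
    also have "\<dots> \<le> game_value cycle_family (star_graph k) n Maxi E"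
      by (rule game_value_Maxi_ge[OF e])
    finally show ?thesis by (simp add: Maxi)
  next
    case Mini
    have "m choose (k - 1) \<le> game_value cycle_family (star_graph k) n Mini E"
    proof (rule game_value_Mini_ge)
      show "legal_moves cycle_family n E \<noteq> {}"
        using legal_moves_empty_iff[OF Suc.prems(1)] Suc.hyps(2) by simp
      fix e assume "e \<in> legal_moves cycle_family n E"
      then obtain a b where ab: "e = {a, b}" "\<not> conn E a b"
        and f: "forest {..<n} (insert e E)" and r: "rest {..<n} E = Suc (rest {..<n} (insert e E))"
        by (rule legal_moves_forestE[OF Suc.prems(1)])
      have "deg E v \<le> deg (insert e E) v" using deg[OF ab(2)] ab(1) by simp
      then show "m choose (k - 1) \<le> game_value cycle_family (star_graph k) n Maxi (insert e E)"
        using Suc.prems(2) Suc.hyps(2) r Mini by (intro Suc.hyps(1) f) auto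
    qed
    then show ?thesis by (simp add: Mini)
  qed
qed

section \<open>The strategy of Mini\<close>

lemma forest_deg_pos_in:
  assumes "forest V E" "deg E x > 0"
  shows "x \<in> V"
proof -
  have "nbrs E x \<noteq> {}" using assms(2) by (auto simp: deg_def)
  then show ?thesis
    using forest_edges[OF assms(1)] by (auto simp: nbrs_def all_edges_def doubleton_eq_iff)
qed

text \<open>Mini's move: join leaves of two nontrivial components, or a leaf of the only one to an
  isolated vertex, or two isolated vertices if there is no edge yet. The \<open>max 1\<close>
  reflects that some nontrivial component exists afterwards.\<close>

lemma exists_leaf_move:
  assumes "finite V" "forest V E" "rest V E > 0"
  shows "\<exists>u\<in>V. \<exists>v\<in>V. \<not> conn E u v \<and> deg E u \<le> 1 \<and> deg E v \<le> 1
    \<and> nontriv V (insert {u, v} E) \<le> max 1 (nontriv V E - 1)"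
proof -
  let ?N = "{v \<in> V. deg E v > 0}"
  consider (none) "?N = {}" | (one) "?N \<noteq> {}" "nontriv V E \<le> 1" | (many) "nontriv V E \<ge> 2"
    by linarith
  then show ?thesis
  proof cases
    case none
    obtain u v where uv: "u \<in> V" "v \<in> V" "\<not> conn E u v"
      using assms rest_pos_iff by blast
    moreover have "deg E u = 0" "deg E v = 0" using none uv by auto
    moreover have "nontriv V E = 0" using none by (simp only: nontriv_def comps_def) simp
    ultimately show ?thesis
      using nontriv_insert_edge[OF assms(1,2) uv] by (intro bexI[of _ u] bexI[of _ v]) auto
  next
    case one
    then obtain x where x: "x \<in> V" "deg E x > 0" by blast
    then obtain a where a: "deg E a = 1" using forest_two_leaves[OF assms(1,2)] by blast
    then have aV: "a \<in> V" using forest_deg_pos_in[OF assms(2)] by simp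
    obtain w where w: "w \<in> V" "\<not> conn E a w"
      using forest_not_conn_of_rest[OF assms(1) aV assms(3)] by blast
    then have "deg E w = 0"
      using nontriv_le_1_conn[OF assms(1) one(2) aV w(1)] a by auto
    then show ?thesis
      using nontriv_insert_edge[OF assms(1,2) aV w] a aV w one(2)
      by (intro bexI[of _ a] bexI[of _ w]) auto
  next
    case many
    then have "\<not> card (comps E ?N) \<le> Suc 0" by (simp add: nontriv_def)
    then obtain c d where "c \<in> comps E ?N" "d \<in> comps E ?N" "c \<noteq> d"
      using assms(1) card_le_Suc0_iff_eq[of "comps E ?N"] by (auto simp: comps_def)
    then obtain x y where "x \<in> ?N" "y \<in> ?N" "Collect (conn E x) \<noteq> Collect (conn E y)"
      unfolding comps_def by blast
    then have xy: "deg E x > 0" "deg E y > 0" "\<not> conn E x y"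
      unfolding conn_class_eq_iff by blast+
    obtain a where a: "deg E a = 1" "conn E x a" using forest_two_leaves[OF assms(1,2) xy(1)] by blast
    obtain b where b: "deg E b = 1" "conn E y b" using forest_two_leaves[OF assms(1,2) xy(2)] by blast
    have V: "a \<in> V" "b \<in> V" using a b forest_deg_pos_in[OF assms(2)] by simp_all
    have "\<not> conn E a b"
      using xy(3) conn_left_cong[OF a(2)] conn_left_cong[OF b(2)] conn_sym[of E] by metis
    then show ?thesis
      using nontriv_insert_edge[OF assms(1,2) V] a b V
      by (intro bexI[of _ a] bexI[of _ b]) auto
  qed
qed

text \<open>The quantity \<open>D\<close> of the introduction; truncated subtraction replaces the
  maximum with 0.\<close>

definition excess :: "'a set \<Rightarrow> 'a set set \<Rightarrow> nat" where
  "excess V E = (\<Sum>v\<in>V. deg E v - 3)"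

lemma excess_eq_0: "(\<And>v. v \<in> V \<Longrightarrow> deg E v \<le> 3) \<Longrightarrow> excess V E = 0"
  by (simp add: excess_def)

lemma excess_insert_leaves:
  assumes "finite V" "forest V E" "\<not> conn E u v" "deg E u \<le> 1" "deg E v \<le> 1"
  shows "excess V (insert {u, v} E) = excess V E"
  unfolding excess_def using assms(4,5)
  by (intro sum.cong) (auto simp: deg_insert_edge[OF assms(1-3)])

lemma excess_insert_isolated:
  assumes "finite V" "forest V E" "\<not> conn E u v" "deg E u = 0"
  shows "excess V (insert {u, v} E) \<le> Suc (excess V E)"
proof -
  have "excess V (insert {u, v} E) \<le> (\<Sum>w\<in>V. (deg E w - 3) + (if w = v then 1 else 0))"
    unfolding excess_def using assms(4)
    by (intro sum_mono) (auto simp: deg_insert_edge[OF assms(1-3)])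
  also have "\<dots> \<le> Suc (excess V E)"
    using assms(1) by (simp add: sum.distrib excess_def)
  finally show ?thesis .
qed

lemma final_score_le:
  assumes "k > 4" "forest {..<n} E" "rest {..<n} E = 0" "excess {..<n} E \<le> T"
  shows "game_value cycle_family (star_graph k) n p E \<le> (3 + T) choose (k - 1)"
proof -
  have "game_value cycle_family (star_graph k) n p E = (\<Sum>v<n. deg E v choose (k - 1))"
    using assms by (intro game_value_forest_end) auto
  also have "\<dots> \<le> (3 + excess {..<n} E) choose (k - 1)"
    unfolding excess_def using assms(1) by (intro sum_choose_le) auto
  also have "\<dots> \<le> (3 + T) choose (k - 1)"
    using assms(4) by (intro binomial_right_mono) simp
  finally show ?thesis .
qed

text \<open>Here \<open>T\<close> is the bound to be kept for the final \<open>excess\<close>, and \<open>(rest V E + 1) div 2\<close> is the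
  number of moves left to Max, each costing at most one. The alternative with \<open>d\<close> describes the
  opening: while all degrees are at most \<open>d\<close>, the next \<open>3 - d\<close> moves of Max are still going to be
  wasted.\<close>

definition maxi_inv :: "nat \<Rightarrow> 'a set \<Rightarrow> 'a set set \<Rightarrow> bool" where
  "maxi_inv T V E \<longleftrightarrow>
    nontriv V E \<le> 1 \<and> excess V E + (rest V E + 1) div 2 \<le> T \<or>
    (\<exists>d\<in>{1, 2}. nontriv V E \<le> 2 \<and> (\<forall>v\<in>V. deg E v \<le> d) \<and> (rest V E + 1) div 2 + d \<le> T + 3)"

text \<open>With Mini to move, Max has \<open>rest V E div 2\<close> moves left. The bounds on
  \<open>nontriv\<close> exceed those of \<open>maxi_inv\<close> by one, as Max may just have opened
  a component that Mini will merge. Degrees at most 2 promise one more wasted move of Max, hence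
  \<open>T + 1\<close>.\<close>

definition mini_inv :: "nat \<Rightarrow> 'a set \<Rightarrow> 'a set set \<Rightarrow> bool" where
  "mini_inv T V E \<longleftrightarrow>
    nontriv V E \<le> 2 \<and> excess V E + rest V E div 2 \<le> T \<or>
    nontriv V E \<le> 3 \<and> (\<forall>v\<in>V. deg E v \<le> 2) \<and> rest V E div 2 \<le> T + 1"

lemma maxi_inv_end: "maxi_inv T V E \<Longrightarrow> excess V E \<le> T"
  unfolding maxi_inv_def using excess_eq_0[of V E] by fastforce

lemma mini_inv_end: "mini_inv T V E \<Longrightarrow> excess V E \<le> T"
  unfolding mini_inv_def using excess_eq_0[of V E] by fastforce

text \<open>With at most one nontrivial component, one end of Max's edge is isolated, so only the
  other can add to \<open>excess\<close>. In the opening nothing is added: degrees at most 1 become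
  at most 2, and degrees at most 2 become at most 3.\<close>

lemma mini_inv_insert:
  assumes "finite V" "forest V E" "u \<in> V" "v \<in> V" "\<not> conn E u v" "maxi_inv T V E"
  shows "mini_inv T V (insert {u, v} E)"
proof -
  let ?E = "insert {u, v} E"
  note deg = deg_insert_edge[OF assms(1,2,5)]
  note nontriv = nontriv_insert_edge[OF assms(1-5)]
  have rest: "rest V E = Suc (rest V ?E)" using assms by (intro rest_insert_edge) auto
  from assms(6) consider
    (one) "nontriv V E \<le> 1" "excess V E + (rest V E + 1) div 2 \<le> T" |
    (deg1) "nontriv V E \<le> 2" "\<forall>v\<in>V. deg E v \<le> 1" "(rest V E + 1) div 2 \<le> T + 2" |
    (deg2) "nontriv V E \<le> 2" "\<forall>v\<in>V. deg E v \<le> 2" "(rest V E + 1) div 2 \<le> T + 1"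
    unfolding maxi_inv_def by fastforce
  then show ?thesis
  proof cases
    case one
    have "deg E u = 0 \<or> deg E v = 0"
      using nontriv_le_1_conn[OF assms(1) one(1) assms(3,4)] assms(5) by auto
    then have "excess V ?E \<le> Suc (excess V E)"
      using excess_insert_isolated[OF assms(1,2,5)] excess_insert_isolated[OF assms(1,2), of v u]
        assms(5) conn_sym[of E v u] by (auto simp: insert_commute)
    moreover have "nontriv V ?E \<le> 2" using nontriv one(1) by linarith
    ultimately show ?thesis using one(2) rest unfolding mini_inv_def by auto
  next
    case deg1
    have "deg ?E w \<le> 2" if "w \<in> V" for w using deg1(2) that deg[of w] by fastforce
    moreover have "nontriv V ?E \<le> 3" using nontriv deg1(1) by linarith
    ultimately show ?thesis using deg1(3) rest unfolding mini_inv_def by auto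
  next
    case deg2
    show ?thesis
    proof (cases "nontriv V ?E \<le> 2")
      case True
      have "excess V ?E = 0"
      proof (rule excess_eq_0)
        show "deg ?E w \<le> 3" if "w \<in> V" for w using deg2(2) that deg[of w] by fastforce
      qed
      then show ?thesis using True deg2(3) rest unfolding mini_inv_def by auto
    next
      case False
      \<comment> \<open>A third nontrivial component can only come from an edge between isolated
        vertices, so all degrees stay at most 2.\<close>
      then have "deg E u = 0" "deg E v = 0" "nontriv V ?E \<le> 3"
        using nontriv deg2(1) by (auto split: if_splits)
      moreover from this have "deg ?E w \<le> 2" if "w \<in> V" for w using deg2(2) that deg[of w] by fastforce
      ultimately show ?thesis using deg2(3) rest unfolding mini_inv_def by auto
    qed
  qed
qed

text \<open>Mini's ends had degree at most 1, so neither \<open>excess\<close> nor the degree bound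
  2 suffers, while a surplus nontrivial component is merged.\<close>

lemma maxi_inv_insert:
  assumes "finite V" "forest V E" "rest V E > 0" "mini_inv T V E"
  shows "\<exists>u\<in>V. \<exists>v\<in>V. \<not> conn E u v \<and> maxi_inv T V (insert {u, v} E)"
proof -
  obtain u v where uv: "u \<in> V" "v \<in> V" "\<not> conn E u v" "deg E u \<le> 1" "deg E v \<le> 1"
    and nontriv: "nontriv V (insert {u, v} E) \<le> max 1 (nontriv V E - 1)"
    using exists_leaf_move[OF assms(1-3)] by blast
  let ?E = "insert {u, v} E"
  have rest: "rest V E = Suc (rest V ?E)" using assms uv by (intro rest_insert_edge) auto
  have excess: "excess V ?E = excess V E"
    using assms(1,2) uv by (intro excess_insert_leaves) auto
  from assms(4) have "maxi_inv T V ?E"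
    unfolding mini_inv_def
  proof
    assume "nontriv V E \<le> 2 \<and> excess V E + rest V E div 2 \<le> T"
    then show ?thesis using nontriv rest excess unfolding maxi_inv_def by auto
  next
    assume *: "nontriv V E \<le> 3 \<and> (\<forall>v\<in>V. deg E v \<le> 2) \<and> rest V E div 2 \<le> T + 1"
    then have "deg ?E w \<le> 2" if "w \<in> V" for w
      using that uv(4,5) deg_insert_edge[OF assms(1,2) uv(3), of w] by auto
    then show ?thesis using * nontriv rest unfolding maxi_inv_def by auto
  qed
  then show ?thesis using uv by blast
qed

text \<open>The two invariants alternate: \<open>mini_inv_insert\<close> handles every move of Max,
  \<open>maxi_inv_insert\<close> finds the answer of Mini, and at the end either one bounds
  \<open>excess\<close> by \<open>T\<close>.\<close>

lemma game_value_star_upper: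
  assumes "k > 4" "forest {..<n} E"
    and "case p of Maxi \<Rightarrow> maxi_inv T {..<n} E | Mini \<Rightarrow> mini_inv T {..<n} E"
  shows "game_value cycle_family (star_graph k) n p E \<le> (3 + T) choose (k - 1)"
  using assms(2,3)
proof (induction "rest {..<n} E" arbitrary: E p)
  case 0
  then have "excess {..<n} E \<le> T"
    using maxi_inv_end mini_inv_end by (cases p) auto
  then show ?case using 0 assms(1) by (intro final_score_le) auto
next
  case (Suc r)
  show ?case
  proof (cases p)
    case Maxi
    have "game_value cycle_family (star_graph k) n Maxi E \<le> (3 + T) choose (k - 1)"
    proof (rule game_value_Maxi_le)
      show "legal_moves cycle_family n E \<noteq> {}"
        using legal_moves_empty_iff[OF Suc.prems(1)] Suc.hyps(2) by simp
      fix e assume "e \<in> legal_moves cycle_family n E"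
      then obtain u v where uv: "e = {u, v}" "u < n" "v < n" "\<not> conn E u v"
        and f: "forest {..<n} (insert e E)" and r: "rest {..<n} E = Suc (rest {..<n} (insert e E))"
        by (rule legal_moves_forestE[OF Suc.prems(1)])
      have "mini_inv T {..<n} (insert e E)"
        using mini_inv_insert[of "{..<n}" E u v T] Suc.prems Maxi uv by simp
      then show "game_value cycle_family (star_graph k) n Mini (insert e E) \<le> (3 + T) choose (k - 1)"
        using Suc.hyps(2) r by (intro Suc.hyps(1) f) auto
    qed
    then show ?thesis by (simp add: Maxi)
  next
    case Mini
    then obtain u v where uv: "u < n" "v < n" "\<not> conn E u v" "maxi_inv T {..<n} (insert {u, v} E)"
      using maxi_inv_insert[of "{..<n}" E T] Suc.prems Suc.hyps(2) by auto
    have e: "{u, v} \<in> legal_moves cycle_family n E"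
      using uv Suc.prems(1) by (auto simp: legal_moves_forest)
    have "game_value cycle_family (star_graph k) n Mini E
        \<le> game_value cycle_family (star_graph k) n Maxi (insert {u, v} E)"
      by (rule game_value_Mini_le[OF e])
    also have "\<dots> \<le> (3 + T) choose (k - 1)"
    proof (rule Suc.hyps(1))
      show "forest {..<n} (insert {u, v} E)" using uv Suc.prems(1) by (intro forest.insert) auto
      show "r = rest {..<n} (insert {u, v} E)"
        using rest_insert_edge[of "{..<n}" u v E] uv Suc.hyps(2) by simp
    qed (use uv in simp)
    finally show ?thesis by (simp add: Mini)
  qed
qed

section \<open>The two bounds\<close>

lemma conn_empty_iff: "conn {} u v \<longleftrightarrow> u = v"
  using conn_isolated[of "{}" u v] by (auto simp: nbrs_def)

lemma deg_empty [simp]: "deg {} v = 0"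
  by (simp add: deg_def nbrs_def)

lemma nontriv_empty [simp]: "nontriv V {} = 0"
  by (simp add: nontriv_def comps_def)

lemma deg_edge: "u \<noteq> v \<Longrightarrow> deg {{u, v}} w = (if w = u \<or> w = v then 1 else 0)"
  using nbrs_insert_edge[of u v "{}" w] by (simp add: deg_def nbrs_def)

lemma first_edge:
  assumes "u < n" "v < n" "u \<noteq> v"
  shows "forest {..<n} {{u, v}}"
    "{u, v} \<in> legal_moves cycle_family n {}" "rest {..<n} {{u, v}} = n - 2"
    "nontriv {..<n} {{u, v}} = 1"
proof -
  have c: "\<not> conn {} u v" using assms by (simp add: conn_empty_iff)
  show "forest {..<n} {{u, v}}" using assms c by (intro forest.insert forest.empty) auto
  show "{u, v} \<in> legal_moves cycle_family n {}"
    using assms c by (auto simp: legal_moves_forest[OF forest.empty])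
  show "rest {..<n} {{u, v}} = n - 2"
    using rest_insert_edge[of "{..<n}" u v "{}"] assms c by (simp add: rest_empty)
  show "nontriv {..<n} {{u, v}} = 1"
    using nontriv_insert_edge[of "{..<n}" "{}" u v] assms c by (simp add: forest.empty)
qed

lemma s1_star_lower:
  assumes "k \<ge> 3"
  shows "n div 2 choose (k - 1) \<le> s1 n (star_graph k) cycle_family"
proof (cases "n = 0")
  case True
  then have "n div 2 choose (k - 1) = 0" using assms by (intro binomial_eq_0) auto
  then show ?thesis by linarith
next
  case False
  \<comment> \<open>Max makes \<open>(n - 1 + 1) div 2 = n div 2\<close> of the \<open>n - 1\<close>
    moves, all of them at vertex 0.\<close>
  then show ?thesis
    unfolding s1_def using assms
    by (intro game_value_star_lower[where v = 0] forest.empty) (auto simp: rest_empty)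
qed

text \<open>The vertex is chosen after Mini's first move, as an end of that edge: degree 1 now, plus
  \<open>(n - 1) div 2\<close> moves of Max, gives at least \<open>n div 2\<close>. For a vertex
  fixed in advance the guarantee would be one less when \<open>n\<close> is even.\<close>

lemma s2_star_lower:
  assumes "k \<ge> 3"
  shows "n div 2 choose (k - 1) \<le> s2 n (star_graph k) cycle_family"
proof (cases "n \<ge> 2")
  case False
  then have "n div 2 choose (k - 1) = 0" using assms by (intro binomial_eq_0) auto
  then show ?thesis by linarith
next
  case True
  show ?thesis
    unfolding s2_def
  proof (rule game_value_Mini_ge)
    have "{0, 1} \<in> legal_moves cycle_family n {}" using True by (intro first_edge) auto
    then show "legal_moves cycle_family n {} \<noteq> {}" by blast
    fix e assume "e \<in> legal_moves cycle_family n {}"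
    then obtain u v where uv: "e = {u, v}" "u < n" "v < n" "u \<noteq> v"
      by (auto simp: legal_moves_forest[OF forest.empty] conn_empty_iff)
    show "n div 2 choose (k - 1) \<le> game_value cycle_family (star_graph k) n Maxi {e}"
      unfolding uv(1) using assms uv first_edge[OF uv(2-4)] True
      by (intro game_value_star_lower[where v = u]) (auto simp: deg_edge)
  qed
qed

lemma s1_star_upper:
  fixes n :: nat
  assumes "k > 4"
  defines "T \<equiv> (n + 1) div 2 - 3"
  shows "s1 n (star_graph k) cycle_family \<le> (3 + T) choose (k - 1)"
proof (cases "even n \<and> n \<ge> 6")
  case False
  then consider "n \<le> 4" | "odd n" by fastforce
  \<comment> \<open>This is the opening alternative of \<open>maxi_inv\<close> with
    \<open>d = 1\<close> for the empty graph. It fails by one for even \<open>n \<ge> 6\<close>,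
    whence the case distinction.\<close>
  then have "n div 2 + 1 \<le> T + 3"
    by cases (auto simp: T_def elim!: oddE)
  then have "maxi_inv T {..<n} {}"
    by (cases n) (auto simp: maxi_inv_def rest_empty)
  then show ?thesis
    unfolding s1_def using assms(1) by (intro game_value_star_upper forest.empty) auto
next
  case True
  show ?thesis
    unfolding s1_def
  proof (rule game_value_Maxi_le)
    have "{0, 1} \<in> legal_moves cycle_family n {}" using True by (intro first_edge) auto
    then show "legal_moves cycle_family n {} \<noteq> {}" by blast
    fix e assume "e \<in> legal_moves cycle_family n {}"
    then obtain u v where uv: "e = {u, v}" "u < n" "v < n" "u \<noteq> v"
      by (auto simp: legal_moves_forest[OF forest.empty] conn_empty_iff)
    note E1 = first_edge[OF uv(2-4)]
    \<comment> \<open>Mini answers with a disjoint edge: otherwise Max would gain a move.\<close>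
    have "card ({..<n} - {u, v}) = n - 2" using uv by simp
    then have "card ({..<n} - {u, v}) \<ge> 2" using True by linarith
    then obtain x y where "{x, y} \<subseteq> {..<n} - {u, v}" "x \<noteq> y"
      by (metis obtain_subset_with_card_n card_2_iff)
    then have xy: "x < n" "y < n" "x \<noteq> y" "x \<noteq> u" "x \<noteq> v" "y \<noteq> u" "y \<noteq> v" by auto
    have c: "\<not> conn {e} x y"
      using xy by (auto simp: uv(1) conn_insert_iff conn_empty_iff)
    let ?E = "insert {x, y} {e}"
    have deg: "deg {e} x = 0" "deg {e} y = 0" using xy uv by (simp_all add: deg_edge)
    have f: "forest {..<n} ?E" using E1 xy c uv(1) by (intro forest.insert) auto
    have "rest {..<n} ?E = n - 3"
      using rest_insert_edge[of "{..<n}" x y "{e}"] xy c E1(3) uv(1) by simp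
    moreover have "nontriv {..<n} ?E = 2"
      using nontriv_insert_edge[of "{..<n}" "{e}" x y] xy c E1(1,4) uv(1) deg by simp
    moreover have "deg ?E w \<le> 1" for w
      using deg_insert_edge[of "{..<n}" "{e}" x y w] c E1(1) uv deg by (auto simp: deg_edge)
    \<comment> \<open>After two disjoint edges \<open>d = 1\<close> still holds and fits exactly:
      for \<open>n = 2 * m\<close> both sides equal \<open>m\<close>.\<close>
    moreover have "(n - 3 + 1) div 2 + 1 \<le> T + 3" using True by (auto simp: T_def elim!: evenE)
    ultimately have "maxi_inv T {..<n} ?E" by (auto simp: maxi_inv_def)
    then have "game_value cycle_family (star_graph k) n Maxi ?E \<le> (3 + T) choose (k - 1)"
      using f assms(1) by (intro game_value_star_upper) auto
    moreover have "{x, y} \<in> legal_moves cycle_family n {e}"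
      using E1(1) uv(1) xy c by (auto simp: legal_moves_forest)
    ultimately show "game_value cycle_family (star_graph k) n Mini {e} \<le> (3 + T) choose (k - 1)"
      using game_value_Mini_le le_trans by blast
  qed
qed

lemma s2_star_upper:
  fixes n :: nat
  assumes "k > 4"
  defines "T \<equiv> (n + 1) div 2 - 3"
  shows "s2 n (star_graph k) cycle_family \<le> (3 + T) choose (k - 1)"
proof (cases "n \<ge> 2")
  case False
  then have "rest {..<n} {} = 0" by (simp add: rest_empty)
  then show ?thesis
    unfolding s2_def using assms(1)
    by (intro final_score_le forest.empty) (auto simp: excess_def)
next
  case True
  then have lt: "0 < n" "1 < n" "(0::nat) \<noteq> 1" by auto
  note E1 = first_edge[OF lt]
  \<comment> \<open>Mini's own first edge keeps all degrees at most 1 and leaves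
    \<open>n - 2\<close> moves with Max to play, so \<open>d = 1\<close> works for either
    parity.\<close>
  have "(n - 2 + 1) div 2 + 1 \<le> T + 3" using True unfolding T_def by linarith
  moreover have "deg {{0, 1}} w \<le> 1" for w :: nat by (simp add: deg_edge)
  ultimately have "maxi_inv T {..<n} {{0, 1}}" using E1 by (auto simp: maxi_inv_def)
  then have "game_value cycle_family (star_graph k) n Maxi {{0, 1}} \<le> (3 + T) choose (k - 1)"
    using E1(1) assms(1) by (intro game_value_star_upper) auto
  then show ?thesis
    unfolding s2_def using game_value_Mini_le[OF E1(2), of "star_graph k"] by linarith
qed

theorem theorem1p5:
  fixes n k :: nat
  assumes "k > 4"
  shows "(nat \<lfloor>real n / 2\<rfloor> choose (k - 1) \<le> s1 n (star_graph k) cycle_family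
          \<and> s1 n (star_graph k) cycle_family \<le> nat \<lceil>real n / 2\<rceil> choose (k - 1))
       \<and> (nat \<lfloor>real n / 2\<rfloor> choose (k - 1) \<le> s2 n (star_graph k) cycle_family
          \<and> s2 n (star_graph k) cycle_family \<le> nat \<lceil>real n / 2\<rceil> choose (k - 1))"
proof -
  have fl: "nat \<lfloor>real n / 2\<rfloor> = n div 2" by linarith
  have ce: "nat \<lceil>real n / 2\<rceil> = (n + 1) div 2" by linarith
  \<comment> \<open>The two sides agree unless the subtraction truncates; then the left side is
    \<open>3 choose (k - 1) = 0\<close>.\<close>
  have "(3 + ((n + 1) div 2 - 3)) choose (k - 1) \<le> (n + 1) div 2 choose (k - 1)"
  proof (cases "(n + 1) div 2 \<ge> 3")
    case False
    then have "(3 + ((n + 1) div 2 - 3)) choose (k - 1) = 0"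
      using assms by (intro binomial_eq_0) auto
    then show ?thesis by linarith
  qed simp
  then show ?thesis
    unfolding fl ce
    using assms s1_star_lower[of k n] s2_star_lower[of k n] s1_star_upper[of k n] s2_star_upper[of k n]
    by (auto intro: le_trans)
qed

end
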